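(* Let $n>5$ be an odd integer not of the form $2^m+1$. Then there exists a Jordan loop of order $n$ which is not left alternative, and hence is not associative.
   Context: A loop is a quasigroup (a magma in which $ax=b$ and $ya=b$ have unique solutions for all $a,b$) with a neutral element. A loop is Jordan if it is commutative and satisfies $x^2(yx)=(x^2y)x$. A loop is left alternative if it satisfies $x(xy)=(xx)y$. "Of the form $2^m+1$" is meant for integers $m\ge 0$. *)

theory Defs
  imports "HOL-Algebra.Coset"
begin

(* The record type monoid only supplies the signature (carrier, product, one);
   no monoid axioms are assumed. *)

locale quasigroup =
  fixes Q :: "('a, 'b) monoid_scheme" (structure)
  assumes m_closed [intro, simp]:
      "\<lbrakk>a \<in> carrier Q; b \<in> carrier Q\<rbrakk> \<Longrightarrow> a \<otimes> b \<in> carrier Q"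
    and ex1_right_factor:
      "\<lbrakk>a \<in> carrier Q; b \<in> carrier Q\<rbrakk> \<Longrightarrow> \<exists>!x. x \<in> carrier Q \<and> a \<otimes> x = b"
    and ex1_left_factor:
      "\<lbrakk>a \<in> carrier Q; b \<in> carrier Q\<rbrakk> \<Longrightarrow> \<exists>!y. y \<in> carrier Q \<and> y \<otimes> a = b"

locale loop = quasigroup +
  assumes one_closed [intro, simp]: "\<one> \<in> carrier Q"
    and l_one [simp]: "x \<in> carrier Q \<Longrightarrow> \<one> \<otimes> x = x"
    and r_one [simp]: "x \<in> carrier Q \<Longrightarrow> x \<otimes> \<one> = x"

locale jordan_loop = loop +
  assumes m_comm: "\<lbrakk>x \<in> carrier Q; y \<in> carrier Q\<rbrakk> \<Longrightarrow> x \<otimes> y = y \<otimes> x"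
    and jordan_identity:
      "\<lbrakk>x \<in> carrier Q; y \<in> carrier Q\<rbrakk> \<Longrightarrow>
        (x \<otimes> x) \<otimes> (y \<otimes> x) = ((x \<otimes> x) \<otimes> y) \<otimes> x"

definition left_alternative :: "('a, 'b) monoid_scheme \<Rightarrow> bool" where
  "left_alternative Q \<longleftrightarrow>
    (\<forall>x\<in>carrier Q. \<forall>y\<in>carrier Q.
      x \<otimes>\<^bsub>Q\<^esub> (x \<otimes>\<^bsub>Q\<^esub> y) = (x \<otimes>\<^bsub>Q\<^esub> x) \<otimes>\<^bsub>Q\<^esub> y)"

definition associative :: "('a, 'b) monoid_scheme \<Rightarrow> bool" where
  "associative Q \<longleftrightarrow>
    (\<forall>x\<in>carrier Q. \<forall>y\<in>carrier Q. \<forall>z\<in>carrier Q.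
      (x \<otimes>\<^bsub>Q\<^esub> y) \<otimes>\<^bsub>Q\<^esub> z = x \<otimes>\<^bsub>Q\<^esub> (y \<otimes>\<^bsub>Q\<^esub> z))"

end

theory Submission
  imports
    Defs
    "HOL-Algebra.Elementary_Groups"
    "HOL-Algebra.Weak_Morphisms"
    "HOL-Library.Countable"
    "HOL-Computational_Algebra.Primes"
begin

text \<open>
  Write \<open>n - 1 = s k\<close> with \<open>s\<close> a power of two and \<open>k > 1\<close> odd. Glue \<open>k\<close> copies of the cyclic
  group of order \<open>s + 1\<close> along their neutral elements; the copies are indexed by a commutative
  idempotent quasigroup of order \<open>k\<close>, which determines the copy that contains a product of elements
  of different copies, and the position inside that copy is computed in a cyclic group of order
  \<open>s\<close>. In the Jordan identity \<open>x\<^sup>2(yx) = (x\<^sup>2y)x\<close> the elements \<open>x\<close> and \<open>x\<^sup>2\<close> lie in a common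
  copy, so that it holds if \<open>y\<close> lies there too, and otherwise both sides lie in the same copy and
  have the same position there. The left alternative law fails for \<open>x\<close>, \<open>y\<close> in distinct copies
  \<open>p\<close>, \<open>q\<close>, because \<open>p(pq) \<noteq> pq\<close>.
\<close>

section \<open>Commutative quasigroups and transport of Jordan loops along injections\<close>

lemma not_left_alternative_imp_not_associative:
  "\<not> left_alternative Q \<Longrightarrow> \<not> associative Q"
  unfolding left_alternative_def associative_def by metis

lemma (in quasigroup) left_cancel:
  "\<lbrakk>a \<in> carrier Q; x \<in> carrier Q; y \<in> carrier Q\<rbrakk> \<Longrightarrow> a \<otimes> x = a \<otimes> y \<longleftrightarrow> x = y"
  by (metis ex1_right_factor m_closed)

lemma commutative_quasigroupI:
  fixes Q (structure)
  assumes closed: "\<And>a b. \<lbrakk>a \<in> carrier Q; b \<in> carrier Q\<rbrakk> \<Longrightarrow> a \<otimes> b \<in> carrier Q"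
    and comm: "\<And>a b. \<lbrakk>a \<in> carrier Q; b \<in> carrier Q\<rbrakk> \<Longrightarrow> a \<otimes> b = b \<otimes> a"
    and ex: "\<And>a b. \<lbrakk>a \<in> carrier Q; b \<in> carrier Q\<rbrakk> \<Longrightarrow> \<exists>x\<in>carrier Q. a \<otimes> x = b"
    and cancel: "\<And>a x y. \<lbrakk>a \<in> carrier Q; x \<in> carrier Q; y \<in> carrier Q; a \<otimes> x = a \<otimes> y\<rbrakk> \<Longrightarrow> x = y"
  shows "quasigroup Q"
proof
  fix a b assume ab: "a \<in> carrier Q" "b \<in> carrier Q"
  show "a \<otimes> b \<in> carrier Q" using closed ab by blast
  show *: "\<exists>!x. x \<in> carrier Q \<and> a \<otimes> x = b"
    using ex[OF ab] cancel[OF ab(1)] by blast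
  then show "\<exists>!y. y \<in> carrier Q \<and> y \<otimes> a = b"
    using comm ab(1) by metis
qed

lemma (in comm_group) is_jordan_loop: "jordan_loop G"
proof -
  have "quasigroup G"
  proof (rule commutative_quasigroupI)
    fix a b assume "a \<in> carrier G" "b \<in> carrier G"
    then show "\<exists>x\<in>carrier G. a \<otimes> x = b"
      by (intro bexI[of _ "inv a \<otimes> b"]) (simp_all add: m_assoc[symmetric])
  qed (auto simp: m_comm)
  then show ?thesis
    by (intro jordan_loop.intro loop.intro loop_axioms.intro jordan_loop_axioms.intro)
       (auto simp: m_ac)
qed

lemma mult_image_group:
  assumes "inj_on f (carrier Q)" "a \<in> carrier Q" "b \<in> carrier Q"
  shows "f a \<otimes>\<^bsub>image_group f Q\<^esub> f b = f (a \<otimes>\<^bsub>Q\<^esub> b)"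
  using assms by (simp add: image_group_def)

text \<open>Transport of structure: it later moves the amalgam from its option type to
  \<open>nat\<close>.\<close>

lemma (in jordan_loop) jordan_loop_image_group:
  assumes inj: "inj_on f (carrier Q)"
  shows "jordan_loop (image_group f Q)"
proof -
  note mult = mult_image_group[OF inj]
  have "quasigroup (image_group f Q)"
  proof (rule commutative_quasigroupI; unfold image_group_carrier; clarify)
    fix a b assume ab: "a \<in> carrier Q" "b \<in> carrier Q"
    then show "\<exists>x\<in>f ` carrier Q. f a \<otimes>\<^bsub>image_group f Q\<^esub> x = f b"
      using ex1_right_factor[OF ab] mult by auto
  next
    fix a x y
    assume *: "a \<in> carrier Q" "x \<in> carrier Q" "y \<in> carrier Q"
      "f a \<otimes>\<^bsub>image_group f Q\<^esub> f x = f a \<otimes>\<^bsub>image_group f Q\<^esub> f y"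
    then have "a \<otimes> x = a \<otimes> y" using inj by (simp add: mult inj_on_eq_iff)
    then show "f x = f y" using * left_cancel by auto
  qed (auto simp: mult m_comm)
  then show ?thesis
    by (intro jordan_loop.intro loop.intro loop_axioms.intro jordan_loop_axioms.intro)
       (auto simp: image_group_carrier image_group_one mult jordan_identity intro: arg_cong[OF m_comm])
qed

lemma (in quasigroup) left_alternative_image_group_iff:
  assumes inj: "inj_on f (carrier Q)"
  shows "left_alternative (image_group f Q) \<longleftrightarrow> left_alternative Q"
  using inj by (simp add: left_alternative_def image_group_carrier mult_image_group inj_on_eq_iff)

section \<open>Copies of a loop glued along the neutral element\<close>

text \<open>\<open>None\<close> is the shared neutral element, \<open>Some (p, a)\<close> the
  non-neutral element \<open>a\<close> of copy \<open>p\<close>. \<open>A\<close> multiplies within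
  a copy, \<open>B\<close> computes positions across copies.\<close>

definition amalgam ::
    "('i, 'c) monoid_scheme \<Rightarrow> ('a, 'd) monoid_scheme \<Rightarrow> ('a, 'e) monoid_scheme \<Rightarrow> ('i \<times> 'a) option monoid"
  where
  "amalgam I A B =
    \<lparr>carrier = insert None (Some ` (carrier I \<times> (carrier A - {\<one>\<^bsub>A\<^esub>}))),
     monoid.mult = (\<lambda>x y. case (x, y) of
         (None, _) \<Rightarrow> y
       | (_, None) \<Rightarrow> x
       | (Some (p, a), Some (q, b)) \<Rightarrow>
           if p \<noteq> q then Some (p \<otimes>\<^bsub>I\<^esub> q, a \<otimes>\<^bsub>B\<^esub> b)
           else if a \<otimes>\<^bsub>A\<^esub> b = \<one>\<^bsub>A\<^esub> then None
           else Some (p, a \<otimes>\<^bsub>A\<^esub> b)),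
     one = None\<rparr>"

text \<open>By \<open>carrier_B\<close> a product across copies is never neutral. Beyond sharing
  these elements, the operations of \<open>A\<close> and \<open>B\<close> are unrelated.\<close>

locale amalgam_data = I: quasigroup I + A: jordan_loop A + B: comm_group B
  for I :: "('i, 'c) monoid_scheme" and A :: "('a, 'd) monoid_scheme"
    and B :: "('a, 'e) monoid_scheme" +
  assumes I_comm: "\<lbrakk>p \<in> carrier I; q \<in> carrier I\<rbrakk> \<Longrightarrow> p \<otimes>\<^bsub>I\<^esub> q = q \<otimes>\<^bsub>I\<^esub> p"
    and I_idem: "p \<in> carrier I \<Longrightarrow> p \<otimes>\<^bsub>I\<^esub> p = p"
    and carrier_B: "carrier B = carrier A - {\<one>\<^bsub>A\<^esub>}"
begin

abbreviation Q where "Q \<equiv> amalgam I A B"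

text \<open>The elements of the copy \<open>p\<close>, in such a form that \<open>elt p \<one>\<close> is the shared neutral element.\<close>

definition elt :: "'i \<Rightarrow> 'a \<Rightarrow> ('i \<times> 'a) option" where
  "elt p a = (if a = \<one>\<^bsub>A\<^esub> then None else Some (p, a))"

lemma one_amalgam [simp]: "\<one>\<^bsub>Q\<^esub> = None"
  by (simp add: amalgam_def)

lemma None_mult [simp]: "None \<otimes>\<^bsub>Q\<^esub> x = x"
  by (simp add: amalgam_def)

lemma mult_None [simp]: "x \<otimes>\<^bsub>Q\<^esub> None = x"
  by (simp add: amalgam_def split: option.split)

lemma elt_mult_same:
  assumes "a \<in> carrier A" "b \<in> carrier A"
  shows "elt p a \<otimes>\<^bsub>Q\<^esub> elt p b = elt p (a \<otimes>\<^bsub>A\<^esub> b)"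
  using assms by (simp add: elt_def) (simp add: amalgam_def)

lemma Some_mult_other:
  "p \<noteq> q \<Longrightarrow> Some (p, a) \<otimes>\<^bsub>Q\<^esub> Some (q, b) = Some (p \<otimes>\<^bsub>I\<^esub> q, a \<otimes>\<^bsub>B\<^esub> b)"
  by (simp add: amalgam_def)

lemma elt_closed: "\<lbrakk>p \<in> carrier I; a \<in> carrier A\<rbrakk> \<Longrightarrow> elt p a \<in> carrier Q"
  by (simp add: elt_def amalgam_def)

lemma Some_closed: "Some (p, a) \<in> carrier Q \<longleftrightarrow> p \<in> carrier I \<and> a \<in> carrier B"
  by (auto simp: amalgam_def carrier_B)

lemma None_closed [simp]: "None \<in> carrier Q"
  by (simp add: amalgam_def)

lemma Some_eq_elt: "a \<in> carrier B \<Longrightarrow> Some (p, a) = elt p a"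
  by (simp add: elt_def carrier_B)

lemma carrier_B_in_A: "a \<in> carrier B \<Longrightarrow> a \<in> carrier A"
  by (simp add: carrier_B)

text \<open>Cancel \<open>p\<close> on the left in \<open>pq = p = pp\<close>. Hence elements of
  distinct copies have their product in a third copy.\<close>

lemma I_mult_eq_iff:
  assumes "p \<in> carrier I" "q \<in> carrier I"
  shows "p \<otimes>\<^bsub>I\<^esub> q = p \<longleftrightarrow> p = q"
  using assms I.left_cancel[of p q p] I_idem by auto

text \<open>Counting the neutral element as \<open>elt p\<close> of the unit spares a third case in
  proofs about a factor from copy \<open>p\<close>.\<close>

lemma copy_cases [consumes 2, case_names same other]:
  assumes "x \<in> carrier Q" "p \<in> carrier I"
  obtains b where "b \<in> carrier A" "x = elt p b"
  | q b where "q \<in> carrier I" "q \<noteq> p" "p \<otimes>\<^bsub>I\<^esub> q \<in> carrier I" "p \<otimes>\<^bsub>I\<^esub> q \<noteq> p"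
      "b \<in> carrier B" "x = Some (q, b)"
proof (cases x)
  case None
  then show thesis using that(1)[of "\<one>\<^bsub>A\<^esub>"] by (simp add: elt_def)
next
  case (Some z)
  obtain q b where z: "z = (q, b)" by force
  then have qb: "q \<in> carrier I" "b \<in> carrier B" using assms(1) Some Some_closed by auto
  show thesis
  proof (cases "q = p")
    case True
    then show thesis using that(1)[of b] qb Some z carrier_B_in_A Some_eq_elt by auto
  next
    case False
    then show thesis using that(2)[of q b] qb Some z assms(2) I_mult_eq_iff[of p q] by auto
  qed
qed

lemma amalgam_comm:
  assumes "x \<in> carrier Q" "y \<in> carrier Q"
  shows "x \<otimes>\<^bsub>Q\<^esub> y = y \<otimes>\<^bsub>Q\<^esub> x"
proof (cases x)
  case (Some z)
  then obtain p a where x: "x = Some (p, a)" by force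
  then have pa: "p \<in> carrier I" "a \<in> carrier B" using assms(1) Some_closed by auto
  from assms(2) pa(1) show ?thesis
  proof (cases rule: copy_cases)
    case (same b)
    then show ?thesis using pa x
      by (simp add: Some_eq_elt elt_mult_same carrier_B_in_A A.m_comm)
  next
    case (other q b)
    then show ?thesis using pa x by (simp add: Some_mult_other B.m_comm I_comm)
  qed
qed simp

text \<open>Left multiplication by \<open>Some (p, a)\<close> acts on copy \<open>p\<close> as a
  translation of \<open>A\<close>. Outside it, the copies other than \<open>p\<close> are permuted
  by \<open>q \<mapsto> pq\<close>, and positions are translated in \<open>B\<close>.\<close>

lemma quasigroup_amalgam: "quasigroup Q"
proof (rule commutative_quasigroupI)
  fix x y assume xy: "x \<in> carrier Q" "y \<in> carrier Q"
  show "x \<otimes>\<^bsub>Q\<^esub> y = y \<otimes>\<^bsub>Q\<^esub> x" using xy by (rule amalgam_comm)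
  have "x \<otimes>\<^bsub>Q\<^esub> y \<in> carrier Q \<and> (\<exists>z\<in>carrier Q. x \<otimes>\<^bsub>Q\<^esub> z = y)"
  proof (cases x)
    case (Some w)
    then obtain p a where x: "x = Some (p, a)" by force
    then have pa: "p \<in> carrier I" "a \<in> carrier B" using xy(1) Some_closed by auto
    then have aA: "a \<in> carrier A" by (simp add: carrier_B_in_A)
    from xy(2) pa(1) show ?thesis
    proof (cases rule: copy_cases)
      case (same b)
      obtain c where c: "c \<in> carrier A" "a \<otimes>\<^bsub>A\<^esub> c = b"
        using A.ex1_right_factor[OF aA same(1)] by blast
      then have "x \<otimes>\<^bsub>Q\<^esub> elt p c = y"
        using same pa x aA by (simp add: Some_eq_elt elt_mult_same)
      moreover have "x \<otimes>\<^bsub>Q\<^esub> y \<in> carrier Q"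
        using same pa x aA by (simp add: Some_eq_elt elt_mult_same elt_closed)
      ultimately show ?thesis using c(1) pa(1) elt_closed by blast
    next
      case (other q b)
      \<comment> \<open>Divide separately: the copy in \<open>I\<close>, the position in the group
        \<open>B\<close>. Idempotence gives \<open>r \<noteq> p\<close>, so the product really is
        one across copies.\<close>
      obtain r where r: "r \<in> carrier I" "p \<otimes>\<^bsub>I\<^esub> r = q"
        using I.ex1_right_factor[OF pa(1) other(1)] by blast
      then have "r \<noteq> p" using other(2) I_idem pa(1) by auto
      then have "x \<otimes>\<^bsub>Q\<^esub> Some (r, inv\<^bsub>B\<^esub> a \<otimes>\<^bsub>B\<^esub> b) = y"
        using other pa x r by (simp add: Some_mult_other B.m_assoc[symmetric])
      moreover have "Some (r, inv\<^bsub>B\<^esub> a \<otimes>\<^bsub>B\<^esub> b) \<in> carrier Q"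
        using other pa r by (simp add: Some_closed)
      moreover have "x \<otimes>\<^bsub>Q\<^esub> y \<in> carrier Q"
        using other pa x by (simp add: Some_mult_other Some_closed)
      ultimately show ?thesis by blast
    qed
  qed (use xy in simp)
  then show "x \<otimes>\<^bsub>Q\<^esub> y \<in> carrier Q" "\<exists>z\<in>carrier Q. x \<otimes>\<^bsub>Q\<^esub> z = y" by auto
next
  fix x y z
  assume xyz: "x \<in> carrier Q" "y \<in> carrier Q" "z \<in> carrier Q" and eq: "x \<otimes>\<^bsub>Q\<^esub> y = x \<otimes>\<^bsub>Q\<^esub> z"
  show "y = z"
  proof (cases x)
    case None
    then show ?thesis using eq by simp
  next
    case (Some w)
    then obtain p a where x: "x = Some (p, a)" by force
    then have pa: "p \<in> carrier I" "a \<in> carrier B" using xyz(1) Some_closed by auto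
    then have aA: "a \<in> carrier A" by (simp add: carrier_B_in_A)
    \<comment> \<open>A product with \<open>x\<close> lies in copy \<open>p\<close> exactly if the
      other factor does, so the two mixed cases below contradict \<open>eq\<close>.\<close>
    have prod_same: "x \<otimes>\<^bsub>Q\<^esub> elt p b = elt p (a \<otimes>\<^bsub>A\<^esub> b)" if "b \<in> carrier A" for b
      using that pa aA x by (simp add: Some_eq_elt elt_mult_same)
    have prod_other: "x \<otimes>\<^bsub>Q\<^esub> Some (q, b) = Some (p \<otimes>\<^bsub>I\<^esub> q, a \<otimes>\<^bsub>B\<^esub> b)" if "q \<noteq> p" for q b
      using that x by (simp add: Some_mult_other)
    have elt_neq: "elt p b \<noteq> Some (q, c)" if "q \<noteq> p" for b c q
      using that by (simp add: elt_def)
    have elt_inj: "elt p b = elt p c \<longleftrightarrow> b = c" for b c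
      by (auto simp: elt_def)
    from xyz(2) pa(1) show ?thesis
    proof (cases rule: copy_cases)
      case y: (same b)
      from xyz(3) pa(1) show ?thesis
      proof (cases rule: copy_cases)
        case (same c)
        then show ?thesis using eq y aA by (simp add: prod_same elt_inj A.left_cancel)
      next
        case (other q c)
        then show ?thesis using eq y by (simp add: prod_same prod_other elt_neq)
      qed
    next
      case y: (other r b)
      from xyz(3) pa(1) show ?thesis
      proof (cases rule: copy_cases)
        case (same c)
        then show ?thesis using eq y
          by (simp add: prod_same prod_other elt_neq[symmetric])
      next
        case (other q c)
        then show ?thesis using eq y pa by (simp add: prod_other I.left_cancel)
      qed
    qed
  qed
qed

theorem jordan_loop_amalgam: "jordan_loop Q"
proof (intro jordan_loop.intro loop.intro loop_axioms.intro jordan_loop_axioms.intro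
    quasigroup_amalgam)
  fix x y assume xy: "x \<in> carrier Q" "y \<in> carrier Q"
  then show "x \<otimes>\<^bsub>Q\<^esub> y = y \<otimes>\<^bsub>Q\<^esub> x" by (rule amalgam_comm)
  show "(x \<otimes>\<^bsub>Q\<^esub> x) \<otimes>\<^bsub>Q\<^esub> (y \<otimes>\<^bsub>Q\<^esub> x) = ((x \<otimes>\<^bsub>Q\<^esub> x) \<otimes>\<^bsub>Q\<^esub> y) \<otimes>\<^bsub>Q\<^esub> x"
  proof (cases x)
    case (Some w)
    then obtain p a where x: "x = Some (p, a)" by force
    then have pa: "p \<in> carrier I" "a \<in> carrier B" using xy(1) Some_closed by auto
    then have aA: "a \<in> carrier A" by (simp add: carrier_B_in_A)
    have x': "x = elt p a" using x pa by (simp add: Some_eq_elt)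
    have xx: "x \<otimes>\<^bsub>Q\<^esub> x = elt p (a \<otimes>\<^bsub>A\<^esub> a)" unfolding x' using aA by (rule elt_mult_same[OF _ aA])
    from xy(2) pa(1) show ?thesis
    proof (cases rule: copy_cases)
      case (same b)
      then show ?thesis
        unfolding xx using x' aA by (simp add: elt_mult_same A.jordan_identity)
    next
      case (other q b)
      show ?thesis
      \<comment> \<open>If the square of \<open>x\<close> is neutral, both sides are
        \<open>yx\<close>; otherwise the square is a proper element of copy
        \<open>p\<close>.\<close>
      proof (cases "a \<otimes>\<^bsub>A\<^esub> a = \<one>\<^bsub>A\<^esub>")
        case True
        then show ?thesis unfolding xx by (simp add: elt_def)
      next
        case False
        then have aaB: "a \<otimes>\<^bsub>A\<^esub> a \<in> carrier B" using aA by (simp add: carrier_B)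
        have ne: "q \<otimes>\<^bsub>I\<^esub> p \<noteq> p" "p \<noteq> q" using other I_comm pa(1) by auto
        have "(x \<otimes>\<^bsub>Q\<^esub> x) \<otimes>\<^bsub>Q\<^esub> (y \<otimes>\<^bsub>Q\<^esub> x)
            = Some (p \<otimes>\<^bsub>I\<^esub> (q \<otimes>\<^bsub>I\<^esub> p), (a \<otimes>\<^bsub>A\<^esub> a) \<otimes>\<^bsub>B\<^esub> (b \<otimes>\<^bsub>B\<^esub> a))"
          unfolding xx Some_eq_elt[OF aaB, symmetric] using other ne x
          by (simp add: Some_mult_other)
        \<comment> \<open>The copies agree by commutativity of \<open>I\<close> alone. The positions
          agree by associativity of \<open>B\<close>, where the square formed in \<open>A\<close>
          counts as a single element.\<close>
        also have "\<dots> = Some ((p \<otimes>\<^bsub>I\<^esub> q) \<otimes>\<^bsub>I\<^esub> p, ((a \<otimes>\<^bsub>A\<^esub> a) \<otimes>\<^bsub>B\<^esub> b) \<otimes>\<^bsub>B\<^esub> a)"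
          using other pa aaB I_comm[of p q] I_comm[of p "p \<otimes>\<^bsub>I\<^esub> q"] by (simp add: B.m_assoc)
        also have "\<dots> = ((x \<otimes>\<^bsub>Q\<^esub> x) \<otimes>\<^bsub>Q\<^esub> y) \<otimes>\<^bsub>Q\<^esub> x"
          unfolding xx Some_eq_elt[OF aaB, symmetric] using other ne x
          by (simp add: Some_mult_other)
        finally show ?thesis .
      qed
    qed
  qed simp
qed simp_all

text \<open>The condition on \<open>a\<close> keeps \<open>xx\<close> in copy \<open>p\<close>, so
  that \<open>(xx)y\<close> lies in copy \<open>pq\<close>, whereas \<open>x(xy)\<close> lies in
  copy \<open>p(pq)\<close>.\<close>

lemma not_left_alternative_amalgam:
  assumes pq: "p \<in> carrier I" "q \<in> carrier I" "p \<noteq> q"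
    and a: "a \<in> carrier A" "a \<otimes>\<^bsub>A\<^esub> a \<noteq> \<one>\<^bsub>A\<^esub>"
  shows "\<not> left_alternative Q"
proof -
  have aB: "a \<in> carrier B" and aaB: "a \<otimes>\<^bsub>A\<^esub> a \<in> carrier B"
    using a by (auto simp: carrier_B)
  let ?x = "Some (p, a)" and ?y = "Some (q, a)"
  have pq': "p \<otimes>\<^bsub>I\<^esub> q \<in> carrier I" "p \<otimes>\<^bsub>I\<^esub> q \<noteq> p"
    using pq I_mult_eq_iff by auto
  \<comment> \<open>Equality would mean \<open>qp = q\<close>, hence \<open>q = p\<close>;
    cancelling \<open>p\<close> then separates \<open>p(pq)\<close> from \<open>pq\<close>.\<close>
  have "p \<otimes>\<^bsub>I\<^esub> q \<noteq> q"
    using I_mult_eq_iff[of q p] I_comm pq by auto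
  then have ne: "p \<otimes>\<^bsub>I\<^esub> (p \<otimes>\<^bsub>I\<^esub> q) \<noteq> p \<otimes>\<^bsub>I\<^esub> q"
    using pq pq' I.left_cancel by auto
  have "?x \<otimes>\<^bsub>Q\<^esub> ?x = Some (p, a \<otimes>\<^bsub>A\<^esub> a)"
    using a aB aaB by (simp add: Some_eq_elt elt_mult_same)
  then have "?x \<otimes>\<^bsub>Q\<^esub> (?x \<otimes>\<^bsub>Q\<^esub> ?y) \<noteq> (?x \<otimes>\<^bsub>Q\<^esub> ?x) \<otimes>\<^bsub>Q\<^esub> ?y"
    using pq pq' ne by (simp add: Some_mult_other)
  moreover have "?x \<in> carrier Q" "?y \<in> carrier Q"
    using pq aB by (simp_all add: Some_closed)
  ultimately show ?thesis
    unfolding left_alternative_def by blast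
qed

lemma finite_carrier_amalgam:
  "\<lbrakk>finite (carrier I); finite (carrier B)\<rbrakk> \<Longrightarrow> finite (carrier Q)"
  by (simp add: amalgam_def carrier_B[symmetric])

lemma order_amalgam:
  assumes "finite (carrier I)" "finite (carrier B)"
  shows "order Q = order I * order B + 1"
  using assms
  by (simp add: order_def amalgam_def carrier_B[symmetric] card_image card_cartesian_product image_iff)

end

section \<open>A commutative idempotent quasigroup of each odd order\<close>

text \<open>\<open>(k + 1) div 2\<close> is the inverse of 2 modulo \<open>k\<close>.\<close>

definition midpoint_quasigroup :: "nat \<Rightarrow> int monoid" where
  "midpoint_quasigroup k =
    \<lparr>carrier = {0..<int k}, monoid.mult = (\<lambda>x y. (x + y) * ((int k + 1) div 2) mod int k), one = 0\<rparr>"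

lemma
  assumes "odd k"
  shows quasigroup_midpoint: "quasigroup (midpoint_quasigroup k)"
    and midpoint_idem: "x \<in> carrier (midpoint_quasigroup k) \<Longrightarrow> x \<otimes>\<^bsub>midpoint_quasigroup k\<^esub> x = x"
proof -
  let ?M = "midpoint_quasigroup k"
  obtain h where h: "int k = 2 * h + 1" using assms by (metis even_of_nat oddE)
  have k: "int k > 0" using assms by (simp add: odd_pos)
  have half: "(int k + 1) div 2 = h + 1" using h by simp
  have carr: "x \<in> carrier ?M \<longleftrightarrow> 0 \<le> x \<and> x < int k" for x
    by (simp add: midpoint_quasigroup_def)
  have mult: "x \<otimes>\<^bsub>?M\<^esub> y = (x + y) * (h + 1) mod int k" for x y
    by (simp add: midpoint_quasigroup_def half)
  have double: "(2 * (h + 1) * x) mod int k = x mod int k" for x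
  proof -
    have "2 * (h + 1) * x = x + int k * x" using h by (simp add: algebra_simps)
    then show ?thesis by simp
  qed
  show "x \<otimes>\<^bsub>?M\<^esub> x = x" if "x \<in> carrier ?M" for x
    using that double[of x] by (simp add: mult carr algebra_simps)
  show "quasigroup ?M"
  proof (rule commutative_quasigroupI)
    fix a b assume ab: "a \<in> carrier ?M" "b \<in> carrier ?M"
    show "a \<otimes>\<^bsub>?M\<^esub> b \<in> carrier ?M" using k by (simp add: mult carr)
    show "a \<otimes>\<^bsub>?M\<^esub> b = b \<otimes>\<^bsub>?M\<^esub> a" by (simp add: mult add.commute)
    \<comment> \<open>The solution is the reflection of \<open>a\<close> in \<open>b\<close>, as
      \<open>b\<close> is the midpoint of \<open>a\<close> and \<open>2b - a\<close>.\<close>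
    have "a \<otimes>\<^bsub>?M\<^esub> ((2 * b - a) mod int k) = (a + (2 * b - a)) * (h + 1) mod int k"
      unfolding mult by (metis mod_add_right_eq mod_mult_left_eq)
    also have "\<dots> = b" using double[of b] ab by (simp add: carr algebra_simps)
    finally show "\<exists>x\<in>carrier ?M. a \<otimes>\<^bsub>?M\<^esub> x = b" using k carr by (metis pos_mod_sign pos_mod_bound)
  next
    fix a x y
    assume "a \<in> carrier ?M" and xy: "x \<in> carrier ?M" "y \<in> carrier ?M"
      and "a \<otimes>\<^bsub>?M\<^esub> x = a \<otimes>\<^bsub>?M\<^esub> y"
    \<comment> \<open>Doubling undoes the halving. Subtracting \<open>a\<close> in the form
      \<open>2 * (h + 1) * a\<close> leaves the same multiple of \<open>x\<close> and of
      \<open>y\<close>.\<close>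
    then have "(2 * ((a + x) * (h + 1)) - 2 * (h + 1) * a) mod int k
        = (2 * ((a + y) * (h + 1)) - 2 * (h + 1) * a) mod int k"
      unfolding mult by (metis mod_diff_left_eq mod_mult_right_eq)
    then have "(2 * (h + 1) * x) mod int k = (2 * (h + 1) * y) mod int k"
      by (simp add: algebra_simps)
    then show "x = y" using xy double by (simp add: carr)
  qed
qed

section \<open>Loops on natural numbers from a factorization of the order minus one\<close>

lemma comm_group_image_group:
  assumes "comm_group G" "inj_on f (carrier G)"
  shows "comm_group (image_group f G)"
proof -
  interpret comm_group G by fact
  show ?thesis
    by (rule group.group_comm_groupI[OF inj_imp_image_group_is_group[OF assms(2)]])
       (auto simp: image_group_carrier mult_image_group[OF assms(2)] m_comm)
qed

theorem ex_jordan_loop_of_factorization: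
  fixes k s :: nat
  assumes "odd k" "k > 1" "s > 1"
  shows "\<exists>Q :: nat monoid. jordan_loop Q \<and> finite (carrier Q) \<and> order Q = k * s + 1 \<and>
    \<not> left_alternative Q"
proof -
  define I where "I = midpoint_quasigroup k"
  define A where "A = integer_mod_group (s + 1)"
  \<comment> \<open>The shift turns the residues \<open>0..s-1\<close> into \<open>1..s\<close>, the
    nonzero elements of \<open>A\<close>.\<close>
  define B where "B = image_group (\<lambda>x. x + 1) (integer_mod_group s)"
  have carrier_I: "carrier I = {0..<int k}" by (simp add: I_def midpoint_quasigroup_def)
  have carrier_B_eq: "carrier B = (\<lambda>x. x + 1) ` {0..<int s}"
    using assms(3) by (simp add: B_def image_group_carrier carrier_integer_mod_group)
  interpret I: quasigroup I unfolding I_def by (rule quasigroup_midpoint[OF assms(1)])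
  interpret A: jordan_loop A unfolding A_def by (simp add: comm_group.is_jordan_loop)
  interpret B: comm_group B unfolding B_def by (rule comm_group_image_group) (auto simp: inj_on_def)
  interpret amalgam_data I A B
  proof
    show "p \<otimes>\<^bsub>I\<^esub> q = q \<otimes>\<^bsub>I\<^esub> p" for p q
      by (simp add: I_def midpoint_quasigroup_def add.commute)
    show "p \<otimes>\<^bsub>I\<^esub> p = p" if "p \<in> carrier I" for p
      using that midpoint_idem[OF assms(1)] by (simp add: I_def)
    show "carrier B = carrier A - {\<one>\<^bsub>A\<^esub>}"
      by (auto simp: carrier_B_eq A_def carrier_integer_mod_group)
  qed
  interpret Q: jordan_loop Q by (rule jordan_loop_amalgam)
  let ?Q = "image_group to_nat Q"
  have inj: "inj_on to_nat (carrier Q)" by (simp add: inj_on_def)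
  have fin: "finite (carrier I)" "finite (carrier B)" by (simp_all add: carrier_I carrier_B_eq)
  have "order B = s" by (simp add: order_def carrier_B_eq card_image)
  then have "order Q = k * s + 1" using order_amalgam[OF fin] by (simp add: order_def carrier_I)
  then have "order ?Q = k * s + 1"
    using inj by (simp add: order_def image_group_carrier card_image)
  moreover have "\<not> left_alternative ?Q"
    unfolding Q.left_alternative_image_group_iff[OF inj]
    \<comment> \<open>Copies \<open>0\<close> and \<open>1\<close> are distinct elements of
      \<open>I\<close> since \<open>k > 1\<close>; the position \<open>1\<close> has square
      \<open>2\<close>, nonzero modulo \<open>s + 1\<close> since \<open>s > 1\<close>.\<close>
    by (rule not_left_alternative_amalgam[of 0 1 1])
       (use assms in \<open>auto simp: carrier_I A_def carrier_integer_mod_group\<close>)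
  moreover have "finite (carrier ?Q)"
    using finite_carrier_amalgam[OF fin] by (simp add: image_group_carrier)
  ultimately show ?thesis using Q.jordan_loop_image_group[OF inj] by blast
qed

theorem proposition3p4:
  fixes n :: nat
  assumes "n > 5" and "odd n" and "\<not> (\<exists>m::nat. n = 2 ^ m + 1)"
  shows "\<exists>Q :: nat monoid. jordan_loop Q \<and> finite (carrier Q) \<and> order Q = n \<and>
    \<not> left_alternative Q \<and> \<not> associative Q"
proof -
  \<comment> \<open>Splitting off the full power of two leaves an odd cofactor \<open>k\<close>. The
    excluded form of \<open>n\<close> is exactly the case \<open>k = 1\<close>.\<close>
  define m where "m = multiplicity 2 (n - 1)"
  obtain k where k: "n - 1 = 2 ^ m * k" "odd k"
    using multiplicity_decompose'[of "n - 1" 2] assms(1) unfolding m_def by auto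
  then have n: "n = k * 2 ^ m + 1" using assms(1) by (simp add: mult.commute)
  have "k > 1"
  proof -
    have "k \<noteq> 0" using k(2) by (cases k) auto
    moreover have "k \<noteq> 1" using assms(3) n by auto
    ultimately show ?thesis by simp
  qed
  \<comment> \<open>With \<open>m = 0\<close> the number \<open>n = k + 1\<close> would be
    even.\<close>
  moreover have "m \<noteq> 0" using assms(2) n k(2) by (cases m) auto
  then have "(2::nat) ^ m > 1" using one_less_power[of "2::nat" m] by simp
  ultimately obtain Q :: "nat monoid" where Q: "jordan_loop Q" "finite (carrier Q)"
      "order Q = n" "\<not> left_alternative Q"
    using ex_jordan_loop_of_factorization[OF k(2)] n by blast
  moreover have "\<not> associative Q"
    using not_left_alternative_imp_not_associative[OF Q(4)] .
  ultimately show ?thesis by blast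
qed

end
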